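(* Let $n\ge 4$ and let $$B=\begin{bmatrix}1 & a_{12} & a_{13}\\ \frac{1}{a_{12}} & 1 & a_{23}\\ \frac{1}{a_{13}} & \frac{1}{a_{23}} & 1\end{bmatrix}$$ with $a_{12},a_{13},a_{23}>0$ and $a_{13}\ge 1$. Let $$A=\begin{bmatrix} B & J_{3,n-3}\\ J_{n-3,3} & J_{n-3}\end{bmatrix}$$ and $q=a_{13}-a_{23}a_{12}$. If one of the following holds: (1) $a_{12}\ge 1$, $a_{23}\ge 1$ and $q\le 0$; (2) $a_{12}\ge 1$, $a_{23}\le 1$ and $q\ge 0$; (3) $a_{12}\le 1$, $a_{23}\ge 1$ and $q\ge 0$, then the Perron eigenvector of $A$ is efficient for $A$.
   Context: $J_{m,k}$ denotes the $m$-by-$k$ all-ones matrix, $J_m=J_{m,m}$. The Perron eigenvector of a positive square matrix is a positive eigenvector associated with its spectral radius (unique up to a positive scalar factor). A vector $w$ with positive entries is efficient for a reciprocal matrix $A$ (an entrywise positive matrix with $a_{ji}=1/a_{ij}$) if, for every positive vector $v$, the entrywise inequality $\left|A-[v_i/v_j]\right|\le\left|A-[w_i/w_j]\right|$ implies $v=w$.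
   Formalization: In the definition of efficient, "implies v = w" is taken as v = c·w for some c > 0; read literally, v = 2w has the same ratios as w, so no vector would be efficient. *)

theory Defs
  imports "Jordan_Normal_Form.Spectral_Radius"
begin

definition ones_mat :: "nat \<Rightarrow> nat \<Rightarrow> real mat" where
  "ones_mat m k = mat m k (\<lambda>_. 1)"

definition positive_vec :: "real vec \<Rightarrow> bool" where
  "positive_vec v \<longleftrightarrow> (\<forall>i < dim_vec v. v $ i > 0)"

definition reciprocal_mat :: "real mat \<Rightarrow> bool" where
  "reciprocal_mat A \<longleftrightarrow> square_mat A \<and>
     (\<forall>i < dim_row A. \<forall>j < dim_row A. A $$ (i,j) > 0 \<and> A $$ (j,i) = 1 / A $$ (i,j))"

text \<open>The eigenvalues entering the spectral radius are the complex ones.\<close>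

definition perron_eigenvector :: "real mat \<Rightarrow> real vec \<Rightarrow> bool" where
  "perron_eigenvector A w \<longleftrightarrow>
     positive_vec w \<and> eigenvector A w (spectral_radius (map_mat complex_of_real A))"

definition ratio_mat :: "real vec \<Rightarrow> real mat" where
  "ratio_mat w = mat (dim_vec w) (dim_vec w) (\<lambda>(i,j). w $ i / w $ j)"

text \<open>
  The ratio matrix of a vector is invariant under positive scaling, so the requirement that
  \<open>v\<close> equals \<open>w\<close> is understood up to a positive scalar factor; read literally, no vector
  would be efficient.
\<close>

definition efficient :: "real mat \<Rightarrow> real vec \<Rightarrow> bool" where
  "efficient A w \<longleftrightarrow> reciprocal_mat A \<and> w \<in> carrier_vec (dim_row A) \<and> positive_vec w \<and>
     (\<forall>v \<in> carrier_vec (dim_row A). positive_vec v \<longrightarrow>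
        (\<forall>i < dim_row A. \<forall>j < dim_row A.
           \<bar>(A - ratio_mat v) $$ (i,j)\<bar> \<le> \<bar>(A - ratio_mat w) $$ (i,j)\<bar>) \<longrightarrow>
        (\<exists>c > 0. v = c \<cdot>\<^sub>v w))"

end

theory Submission
  imports Defs
begin

text \<open>
  Draw an edge from \<open>i\<close> to \<open>j\<close> whenever \<open>a\<^sub>i\<^sub>j \<le> w\<^sub>i / w\<^sub>j\<close>. If \<open>v\<close> approximates \<open>A\<close> at least as
  well as \<open>w\<close> in every entry, then \<open>v\<^sub>i / w\<^sub>i \<le> v\<^sub>j / w\<^sub>j\<close> along edges, so \<open>w\<close> is efficient as soon
  as this digraph is strongly connected. For the matrix in question the entries of \<open>w\<close> beyond the
  third all coincide, and subtracting the rows of the eigenvalue equation from each other determines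
  enough edges to exhibit a cycle through the first four vertices: \<open>1 \<rightarrow> 4 \<rightarrow> 3 \<rightarrow> 2 \<rightarrow> 1\<close>,
  \<open>1 \<rightarrow> 4 \<rightarrow> 2 \<rightarrow> 3 \<rightarrow> 1\<close> and \<open>1 \<rightarrow> 2 \<rightarrow> 4 \<rightarrow> 3 \<rightarrow> 1\<close> in the three cases.
\<close>

text \<open>The comparison is multiplied out so that eigenvalue equations apply without division;
  for positive \<open>w\<close> it says \<open>A $$ (i,j) \<le> w $ i / w $ j\<close>.\<close>

definition dominance_edges :: "real mat \<Rightarrow> real vec \<Rightarrow> (nat \<times> nat) set" where
  "dominance_edges A w =
     {(i, j). i < dim_row A \<and> j < dim_row A \<and> A $$ (i,j) * w $ j \<le> w $ i}"

lemma efficient_if_strongly_connected: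
  assumes rec: "reciprocal_mat A" and w: "w \<in> carrier_vec (dim_row A)" and wpos: "positive_vec w"
    and conn: "\<And>i j. i < dim_row A \<Longrightarrow> j < dim_row A \<Longrightarrow> (i, j) \<in> (dominance_edges A w)\<^sup>*"
  shows "efficient A w"
  unfolding efficient_def
proof (intro conjI ballI impI rec w wpos)
  fix v
  assume v: "v \<in> carrier_vec (dim_row A)" and vpos: "positive_vec v"
    and le: "\<forall>i < dim_row A. \<forall>j < dim_row A.
           \<bar>(A - ratio_mat v) $$ (i,j)\<bar> \<le> \<bar>(A - ratio_mat w) $$ (i,j)\<bar>"
  have w0: "w $ i > 0" and v0: "v $ i > 0" if "i < dim_row A" for i
    using that w v wpos vpos by (auto simp: positive_vec_def)
  have edge: "v $ i / w $ i \<le> v $ j / w $ j" if "(i, j) \<in> dominance_edges A w" for i j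
  proof -
    have ij: "i < dim_row A" "j < dim_row A" and d: "A $$ (i,j) * w $ j \<le> w $ i"
      using that by (auto simp: dominance_edges_def)
    have "\<bar>A $$ (i,j) - v $ i / v $ j\<bar> \<le> \<bar>A $$ (i,j) - w $ i / w $ j\<bar>"
      using le[rule_format, OF ij] ij v w by (simp add: ratio_mat_def)
    moreover have "A $$ (i,j) \<le> w $ i / w $ j"
      using d w0[OF ij(2)] by (simp add: field_simps)
    \<comment> \<open>On an edge the right-hand absolute value is
      \<open>w $ i / w $ j - A $$ (i,j)\<close>, so the bound caps \<open>v $ i / v $ j\<close> from
      above.\<close>
    ultimately have "v $ i / v $ j \<le> w $ i / w $ j" by linarith
    then show ?thesis
      using w0[OF ij(1)] w0[OF ij(2)] v0[OF ij(2)] by (simp add: field_simps)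
  qed
  have path: "v $ i / w $ i \<le> v $ j / w $ j" if "(i, j) \<in> (dominance_edges A w)\<^sup>*" for i j
    using that by induction (auto dest: edge)
  have eq: "v $ i / w $ i = v $ j / w $ j" if "i < dim_row A" "j < dim_row A" for i j
    using path conn that by (meson order.antisym)
  show "\<exists>c > 0. v = c \<cdot>\<^sub>v w"
  \<comment> \<open>The scaling factor is read off at index 0, which must therefore exist.\<close>
  proof (cases "dim_row A = 0")
    case True
    then have "v = 1 \<cdot>\<^sub>v w" using v w by auto
    then show ?thesis by (intro exI[of _ 1]) simp
  next
    case False
    define c where "c = v $ 0 / w $ 0"
    have "v = c \<cdot>\<^sub>v w"
    proof (rule eq_vecI)
      fix i assume "i < dim_vec (c \<cdot>\<^sub>v w)"
      then have i: "i < dim_row A" using w by simp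
      have "v $ i / w $ i = c" unfolding c_def using eq[OF i] False by simp
      then show "v $ i = (c \<cdot>\<^sub>v w) $ i" using i w w0[OF i] by (simp add: field_simps)
    qed (use v w in simp)
    moreover have "c > 0" unfolding c_def using w0 v0 False by simp
    ultimately show ?thesis by blast
  qed
qed

lemma four_cycle_connected:
  assumes "(a, b) \<in> E" "(b, c) \<in> E" "(c, d) \<in> E" "(d, a) \<in> E"
    and "i \<in> {a, b, c, d}" "j \<in> {a, b, c, d}"
  shows "(i, j) \<in> E\<^sup>*"
proof -
  have ab: "(a, b) \<in> E\<^sup>*" and da: "(d, a) \<in> E\<^sup>*" using assms(1,4) by auto
  have ac: "(a, c) \<in> E\<^sup>*" using ab assms(2) by (rule rtrancl_into_rtrancl)
  have ad: "(a, d) \<in> E\<^sup>*" using ac assms(3) by (rule rtrancl_into_rtrancl)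
  have ca: "(c, a) \<in> E\<^sup>*" using assms(3) da by (rule converse_rtrancl_into_rtrancl)
  have ba: "(b, a) \<in> E\<^sup>*" using assms(2) ca by (rule converse_rtrancl_into_rtrancl)
  have "(i, a) \<in> E\<^sup>*" "(a, j) \<in> E\<^sup>*" using assms(5,6) ab ac ad da ca ba by auto
  then show ?thesis by (rule rtrancl_trans)
qed

text \<open>Rows of the eigenvalue equation supply \<open>l * y\<close> and \<open>l * x\<close>
  rather than \<open>y\<close> and \<open>x\<close>; since \<open>d\<close> is \<open>l\<close>
  times \<open>y - c * x\<close>, its sign decides the comparison.\<close>

lemma pos_scaled_le_iff:
  fixes l c x y d :: real
  assumes "l > 0" and "l * y - c * (l * x) = d"
  shows "c * x \<le> y \<longleftrightarrow> d \<ge> 0" and "y \<le> c * x \<longleftrightarrow> d \<le> 0"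
proof -
  have d: "d = l * (y - c * x)" using assms(2) by (simp add: algebra_simps)
  show "c * x \<le> y \<longleftrightarrow> d \<ge> 0" and "y \<le> c * x \<longleftrightarrow> d \<le> 0"
    unfolding d using assms(1) by (auto simp: zero_le_mult_iff mult_le_0_iff)
qed

theorem theorem21:
  fixes n :: nat and a12 a13 a23 q :: real and A B :: "real mat" and w :: "real vec"
  assumes "n \<ge> 4"
    and "a12 > 0" and "a13 > 0" and "a23 > 0" and "a13 \<ge> 1"
    and B_def: "B = mat_of_rows_list 3
      [[1,       a12,     a13],
       [1 / a12, 1,       a23],
       [1 / a13, 1 / a23, 1  ]]"
    and A_def: "A = four_block_mat B (ones_mat 3 (n - 3))
                      (ones_mat (n - 3) 3) (ones_mat (n - 3) (n - 3))"
    and q_def: "q = a13 - a23 * a12"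
    and "(a12 \<ge> 1 \<and> a23 \<ge> 1 \<and> q \<le> 0) \<or>
         (a12 \<ge> 1 \<and> a23 \<le> 1 \<and> q \<ge> 0) \<or>
         (a12 \<le> 1 \<and> a23 \<ge> 1 \<and> q \<ge> 0)"
    and "perron_eigenvector A w"
  shows "efficient A w"
proof -
  note pos = assms(2-5) and cases = assms(9)
  define E where "E = dominance_edges A w"
  have dim: "dim_row A = n" "dim_col A = n"
    using \<open>n \<ge> 4\<close> by (auto simp: A_def B_def ones_mat_def mat_of_rows_list_def)
  have entry: "A $$ (i,j) = (if i < 3 \<and> j < 3
      then [[1, a12, a13], [1 / a12, 1, a23], [1 / a13, 1 / a23, 1]] ! i ! j else 1)"
    if "i < n" "j < n" for i j
    using that by (auto simp: A_def B_def ones_mat_def mat_of_rows_list_def)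
  have less3: "i < 3 \<longleftrightarrow> i = 0 \<or> i = 1 \<or> i = 2" for i :: nat by auto
  have rec: "reciprocal_mat A"
    unfolding reciprocal_mat_def
    using pos by (auto simp: dim entry less3 numeral_2_eq_2)
  obtain l where wpos: "positive_vec w" and ev: "eigenvector A w l"
    using assms(10) unfolding perron_eigenvector_def by blast
  have w: "w \<in> carrier_vec n" and eq: "A *\<^sub>v w = l \<cdot>\<^sub>v w"
    using ev by (auto simp: eigenvector_def dim)
  have w0: "w $ i > 0" if "i < n" for i
    using that w wpos by (auto simp: positive_vec_def)
  \<comment> \<open>Indices start at 0, so vertices 1 to 4 of the outline are 0 to 3 here. The tail
    sum \<open>t\<close> enters every row with coefficient 1.\<close>
  define x y z u t where "x = w $ 0" and "y = w $ 1" and "z = w $ 2" and "u = w $ 3"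
    and "t = (\<Sum>j = 3..<n. w $ j)"
  have xyz: "x > 0" "y > 0" "z > 0" "u > 0"
    using w0 \<open>n \<ge> 4\<close> by (auto simp: x_def y_def z_def u_def)
  have t: "t > 0" unfolding t_def by (rule sum_pos) (use w0 \<open>n \<ge> 4\<close> in auto)
  have row: "l * w $ i = A $$ (i,0) * x + A $$ (i,1) * y + A $$ (i,2) * z + t" if i: "i < n" for i
  proof -
    have "l * w $ i = (A *\<^sub>v w) $ i" using i w by (simp add: eq)
    also have "\<dots> = (\<Sum>j = 0..<n. A $$ (i,j) * w $ j)"
      using i w by (simp add: dim scalar_prod_def)
    also have "\<dots> = (\<Sum>j = 0..<3. A $$ (i,j) * w $ j) + (\<Sum>j = 3..<n. A $$ (i,j) * w $ j)"
      using \<open>n \<ge> 4\<close> by (intro sum.atLeastLessThan_concat[symmetric]) auto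
    also have "(\<Sum>j = 3..<n. A $$ (i,j) * w $ j) = t"
      unfolding t_def by (rule sum.cong) (use i in \<open>auto simp: entry\<close>)
    finally show ?thesis by (simp add: numeral_3_eq_3 numeral_2_eq_2 x_def y_def z_def)
  qed
  have rx: "l * x = x + a12 * y + a13 * z + t"
    and ry: "l * y = x / a12 + y + a23 * z + t"
    and rz: "l * z = x / a13 + y / a23 + z + t"
    and ru: "l * u = x + y + z + t"
    using row[of 0] row[of 1] row[of 2] row[of 3] \<open>n \<ge> 4\<close>
    by (simp_all add: entry x_def y_def z_def u_def)
  have l: "l > 0"
  proof -
    have "l * u > 0" using ru xyz t by linarith
    then show ?thesis using xyz by (simp add: zero_less_mult_iff)
  qed
  have tail: "w $ i = u" if "3 \<le> i" "i < n" for i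
  proof -
    have "l * w $ i = l * u" using row[of i] ru that \<open>n \<ge> 4\<close> by (simp add: entry)
    then show ?thesis using l by simp
  qed

  \<comment> \<open>Subtracting the all-ones row 3 cancels \<open>t\<close> and one of
    \<open>x\<close>, \<open>y\<close>, \<open>z\<close>.\<close>
  have d_ux: "l * x - 1 * (l * u) = (a12 - 1) * y + (a13 - 1) * z"
    and d_uy: "l * y - 1 * (l * u) = (1 / a12 - 1) * x + (a23 - 1) * z"
    and d_uz: "l * z - 1 * (l * u) = (1 / a13 - 1) * x + (1 / a23 - 1) * y"
    unfolding rx ry rz ru by (simp_all add: algebra_simps)
  \<comment> \<open>Scaling one row by the matrix entry linking the two vertices cancels both of
    their variables. The third variable survives with a coefficient whose sign is that of
    \<open>q\<close>, reversed in \<open>d_xz\<close>.\<close>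
  have d_xy: "l * x - a12 * (l * y) = q * z - (a12 - 1) * t"
    and d_xz: "l * x - a13 * (l * z) = (- q / a23) * y - (a13 - 1) * t"
    and d_yz: "l * y - a23 * (l * z) = q / (a12 * a13) * x - (a23 - 1) * t"
    unfolding rx ry rz q_def using pos by (simp_all add: field_simps)
  note iff = pos_scaled_le_iff[OF l]

  have edge: "(i, j) \<in> E" if "i < n" "j < n" "A $$ (i,j) * w $ j \<le> w $ i" for i j
    using that by (simp add: E_def dominance_edges_def dim)
  have e03: "(0, 3) \<in> E" if "u \<le> x"
    using that \<open>n \<ge> 4\<close> by (intro edge) (simp_all add: entry x_def u_def)
  have e31: "(3, 1) \<in> E" if "y \<le> u"
    using that \<open>n \<ge> 4\<close> by (intro edge) (simp_all add: entry y_def u_def)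
  have e13: "(1, 3) \<in> E" if "u \<le> y"
    using that \<open>n \<ge> 4\<close> by (intro edge) (simp_all add: entry y_def u_def)
  have e32: "(3, 2) \<in> E" if "z \<le> u"
    using that \<open>n \<ge> 4\<close> by (intro edge) (simp_all add: entry z_def u_def)
  have e01: "(0, 1) \<in> E" if "a12 * y \<le> x"
    using that \<open>n \<ge> 4\<close> by (intro edge) (simp_all add: entry x_def y_def)
  \<comment> \<open>Below the diagonal the entry is a reciprocal, so the edge condition is the
    reverse of the one for \<open>e01\<close>.\<close>
  have e10: "(1, 0) \<in> E" if "x \<le> a12 * y"
    using that \<open>n \<ge> 4\<close> pos by (intro edge) (simp_all add: entry x_def y_def field_simps)
  have e20: "(2, 0) \<in> E" if "x \<le> a13 * z"
    using that \<open>n \<ge> 4\<close> pos by (intro edge) (simp_all add: entry x_def z_def field_simps)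
  have e12: "(1, 2) \<in> E" if "a23 * z \<le> y"
    using that \<open>n \<ge> 4\<close> by (intro edge) (simp_all add: entry y_def z_def)
  have e21: "(2, 1) \<in> E" if "y \<le> a23 * z"
    using that \<open>n \<ge> 4\<close> pos by (intro edge) (simp_all add: entry y_def z_def field_simps)

  have inv_le: "1 / a \<le> 1" if "a \<ge> 1" for a :: real using that by simp
  have inv_ge: "1 / a \<ge> 1" if "a \<le> 1" "a > 0" for a :: real using that by simp
  \<comment> \<open>These rules match the two-term right-hand sides above and reduce each sign to
    the signs of the coefficients.\<close>
  have nonneg: "a * b + c * d \<ge> 0" if "a \<ge> 0" "b \<ge> 0" "c \<ge> 0" "d \<ge> 0" for a b c d :: real
    using that by simp
  have nonpos: "a * b + c * d \<le> 0" if "a \<le> 0" "b \<ge> 0" "c \<le> 0" "d \<ge> 0" for a b c d :: real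
    using that by (simp add: add_nonpos_nonpos mult_nonpos_nonneg)
  have nonneg': "a * b - c * d \<ge> 0" if "a \<ge> 0" "b \<ge> 0" "c \<le> 0" "d \<ge> 0" for a b c d :: real
    using nonneg[of a b "- c" d] that by simp
  have nonpos': "a * b - c * d \<le> 0" if "a \<le> 0" "b \<ge> 0" "c \<ge> 0" "d \<ge> 0" for a b c d :: real
    using nonpos[of a b "- c" d] that by simp

  have "{(0, 3), (3, 2), (2, 1), (1, 0)} \<subseteq> E \<or> {(0, 3), (3, 1), (1, 2), (2, 0)} \<subseteq> E
      \<or> {(0, 1), (1, 3), (3, 2), (2, 0)} \<subseteq> E"
    using cases
  proof (elim disjE conjE)
    assume h: "a12 \<ge> 1" "a23 \<ge> 1" "q \<le> 0"
    \<comment> \<open>The factor \<open>1\<close> keeps the shape \<open>c * x \<le> y\<close> that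
      \<open>iff\<close> rewrites.\<close>
    have "1 * u \<le> x" unfolding iff(1)[OF d_ux] by (rule nonneg) (use h pos xyz in auto)
    moreover have "z \<le> 1 * u"
      unfolding iff(2)[OF d_uz] by (rule nonpos) (use h pos xyz inv_le in auto)
    moreover have "y \<le> a23 * z"
      unfolding iff(2)[OF d_yz]
      by (rule nonpos') (use h pos xyz t in \<open>auto simp: divide_le_0_iff\<close>)
    moreover have "x \<le> a12 * y"
      unfolding iff(2)[OF d_xy] by (rule nonpos') (use h pos xyz t in auto)
    ultimately show ?thesis using e03 e32 e21 e10 by simp
  next
    assume h: "a12 \<ge> 1" "a23 \<le> 1" "q \<ge> 0"
    have "1 * u \<le> x" unfolding iff(1)[OF d_ux] by (rule nonneg) (use h pos xyz in auto)
    moreover have "y \<le> 1 * u"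
      unfolding iff(2)[OF d_uy] by (rule nonpos) (use h pos xyz inv_le in auto)
    moreover have "a23 * z \<le> y"
      unfolding iff(1)[OF d_yz] by (rule nonneg') (use h pos xyz t in auto)
    moreover have "x \<le> a13 * z"
      unfolding iff(2)[OF d_xz] by (rule nonpos') (use h pos xyz t in auto)
    ultimately show ?thesis using e03 e31 e12 e20 by simp
  next
    assume h: "a12 \<le> 1" "a23 \<ge> 1" "q \<ge> 0"
    have "a12 * y \<le> x" unfolding iff(1)[OF d_xy] by (rule nonneg') (use h pos xyz t in auto)
    moreover have "1 * u \<le> y"
      unfolding iff(1)[OF d_uy] by (rule nonneg) (use h pos xyz inv_ge in auto)
    moreover have "z \<le> 1 * u"
      unfolding iff(2)[OF d_uz] by (rule nonpos) (use h pos xyz inv_le in auto)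
    moreover have "x \<le> a13 * z"
      unfolding iff(2)[OF d_xz] by (rule nonpos') (use h pos xyz t in auto)
    ultimately show ?thesis using e01 e13 e32 e20 by simp
  qed
  then have cycle: "(i, 3) \<in> E\<^sup>* \<and> (3, i) \<in> E\<^sup>*" if "i = 0 \<or> i = 1 \<or> i = 2" for i
    using that four_cycle_connected[of 0 3 E 2 1] four_cycle_connected[of 0 3 E 1 2]
      four_cycle_connected[of 0 1 E 3 2]
    by (elim disjE) simp_all
  \<comment> \<open>Beyond the third entry, \<open>w $ i = u\<close> and the matrix entries are 1,
    so the edge condition to and from vertex 3 holds with equality.\<close>
  have hub: "(i, 3) \<in> E\<^sup>* \<and> (3, i) \<in> E\<^sup>*" if "i < n" for i
  proof (cases "i < 3")
    case True
    then show ?thesis using cycle less3 by blast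
  next
    case False
    then have "(i, 3) \<in> E" "(3, i) \<in> E"
      using that \<open>n \<ge> 4\<close> tail[of i] by (auto intro!: edge simp: entry u_def)
    then show ?thesis by blast
  qed
  show ?thesis
  proof (rule efficient_if_strongly_connected[OF rec _ wpos])
    show "w \<in> carrier_vec (dim_row A)" using w dim by simp
    show "(i, j) \<in> (dominance_edges A w)\<^sup>*" if "i < dim_row A" "j < dim_row A" for i j
      using hub[of i] hub[of j] that unfolding dim E_def by (meson rtrancl_trans)
  qed
qed

end
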